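(* Let $(\Xi,\rho,\theta,\Sigma)$ be a continuous groupoid action with $\Sigma$ non-empty, and suppose that it is weakly mixing. Then $\rho(\Sigma)=X$ consists of a single point, so the groupoid $\Xi$ is a group.
   Context: All topological spaces (in particular $\Xi$, $X$ and $\Sigma$) are Hausdorff. A groupoid $\Xi$ is a small category in which all arrows are invertible; $X=\Xi^{(0)}$ is its unit space, $d,r:\Xi\to X$ are the source and range maps, and $\xi\eta$ is defined iff $d(\xi)=r(\eta)$. A topological groupoid is a groupoid with a (Hausdorff) topology making inversion and multiplication continuous (composable pairs carry the topology induced from $\Xi\times\Xi$); $X$ has the subspace topology. A continuous groupoid action $(\Xi,\rho,\theta,\Sigma)$ consists of a topological groupoid $\Xi$, a Hausdorff space $\Sigma$, a continuous surjection $\rho:\Sigma\to X$ (the anchor) and a continuous map $\theta:\{(\xi,\sigma)\in\Xi\times\Sigma: d(\xi)=\rho(\sigma)\}\to\Sigma$, $\theta_\xi(\sigma)=\xi\bullet\sigma$, with $\rho(\sigma)\bullet\sigma=\sigma$ and: if $d(\xi)=r(\eta)$ and $d(\eta)=\rho(\sigma)$ then $d(\xi)=\rho(\eta\bullet\sigma)$ and $(\xi\eta)\bullet\sigma=\xi\bullet(\eta\bullet\sigma)$. For $M,N\subset\Sigma$, $\xi\bullet M=\{\xi\bullet\sigma:\sigma\in M,\ \rho(\sigma)=d(\xi)\}$ and $\widetilde\Xi_M^N=\{\xi\in\Xi:(\xi\bullet M)\cap N\neq\emptyset\}$. The action is weakly mixing if for all non-empty open sets $U,U',V,V'\subset\Sigma$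 one has $\widetilde\Xi_U^V\cap\widetilde\Xi_{U'}^{V'}\neq\emptyset$. *)

theory Defs
  imports "HOL-Analysis.Analysis" "HOL-Algebra.Group"
begin

text \<open>Arrows-only presentation: objects are identified with their identity arrows, so the
  unit space is a subset of the set of arrows. The product \<open>mul \<xi> \<eta>\<close> is meaningful only when
  \<open>d \<xi> = r \<eta>\<close>; outside the composable pairs its values are arbitrary.\<close>

locale small_category =
  fixes arrows units :: "'g set"
    and d r :: "'g \<Rightarrow> 'g"
    and mul :: "'g \<Rightarrow> 'g \<Rightarrow> 'g"
  assumes units_subset: "units \<subseteq> arrows"
    and d_in_units: "\<xi> \<in> arrows \<Longrightarrow> d \<xi> \<in> units"
    and r_in_units: "\<xi> \<in> arrows \<Longrightarrow> r \<xi> \<in> units"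
    and d_unit: "x \<in> units \<Longrightarrow> d x = x"
    and r_unit: "x \<in> units \<Longrightarrow> r x = x"
    and mul_closed: "\<lbrakk>\<xi> \<in> arrows; \<eta> \<in> arrows; d \<xi> = r \<eta>\<rbrakk> \<Longrightarrow> mul \<xi> \<eta> \<in> arrows"
    and d_mul: "\<lbrakk>\<xi> \<in> arrows; \<eta> \<in> arrows; d \<xi> = r \<eta>\<rbrakk> \<Longrightarrow> d (mul \<xi> \<eta>) = d \<eta>"
    and r_mul: "\<lbrakk>\<xi> \<in> arrows; \<eta> \<in> arrows; d \<xi> = r \<eta>\<rbrakk> \<Longrightarrow> r (mul \<xi> \<eta>) = r \<xi>"
    and mul_assoc: "\<lbrakk>\<xi> \<in> arrows; \<eta> \<in> arrows; \<zeta> \<in> arrows; d \<xi> = r \<eta>; d \<eta> = r \<zeta>\<rbrakk>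
      \<Longrightarrow> mul (mul \<xi> \<eta>) \<zeta> = mul \<xi> (mul \<eta> \<zeta>)"
    and mul_d: "\<xi> \<in> arrows \<Longrightarrow> mul \<xi> (d \<xi>) = \<xi>"
    and r_mul_left: "\<xi> \<in> arrows \<Longrightarrow> mul (r \<xi>) \<xi> = \<xi>"
begin

definition is_inverse :: "'g \<Rightarrow> 'g \<Rightarrow> bool" where
  "is_inverse \<xi> \<eta> \<longleftrightarrow> \<eta> \<in> arrows \<and> d \<eta> = r \<xi> \<and> r \<eta> = d \<xi> \<and> mul \<xi> \<eta> = r \<xi> \<and> mul \<eta> \<xi> = d \<xi>"

end

locale groupoid = small_category +
  assumes invertible: "\<xi> \<in> arrows \<Longrightarrow> \<exists>\<eta>. is_inverse \<xi> \<eta>"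
begin

definition ginv :: "'a \<Rightarrow> 'a" where
  "ginv \<xi> = (THE \<eta>. is_inverse \<xi> \<eta>)"

lemma is_inverse_ginv:
  assumes "\<xi> \<in> arrows"
  shows "is_inverse \<xi> (ginv \<xi>)"
proof -
  obtain \<eta> where \<eta>: "is_inverse \<xi> \<eta>"
    using invertible[OF assms] by blast
  have "\<zeta> = \<eta>" if \<zeta>: "is_inverse \<xi> \<zeta>" for \<zeta>
  proof -
    have "\<zeta> = mul \<zeta> (mul \<xi> \<eta>)"
      using \<zeta> \<eta> mul_d[of \<zeta>] by (simp add: is_inverse_def)
    also have "\<dots> = mul (mul \<zeta> \<xi>) \<eta>"
      using \<zeta> \<eta> assms mul_assoc[of \<zeta> \<xi> \<eta>] by (simp add: is_inverse_def)
    also have "\<dots> = \<eta>"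
      using \<zeta> \<eta> r_mul_left[of \<eta>] by (simp add: is_inverse_def)
    finally show ?thesis .
  qed
  then show ?thesis
    unfolding ginv_def using \<eta> by (metis theI)
qed

end

locale topological_groupoid = groupoid "topspace T" units d r mul
  for T :: "'g topology" and units :: "'g set" and d r :: "'g \<Rightarrow> 'g"
    and mul :: "'g \<Rightarrow> 'g \<Rightarrow> 'g" +
  assumes Hausdorff_arrows: "Hausdorff_space T"
    and continuous_ginv: "continuous_map T T ginv"
    and continuous_mul:
      "continuous_map (subtopology (prod_topology T T) {(\<xi>, \<eta>). d \<xi> = r \<eta>}) T
        (\<lambda>(\<xi>, \<eta>). mul \<xi> \<eta>)"

locale continuous_groupoid_action = topological_groupoid T units d r mul
  for T :: "'g topology" and units :: "'g set" and d r :: "'g \<Rightarrow> 'g"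
    and mul :: "'g \<Rightarrow> 'g \<Rightarrow> 'g" +
  fixes S :: "'s topology" and \<rho> :: "'s \<Rightarrow> 'g" and act :: "'g \<Rightarrow> 's \<Rightarrow> 's"
  assumes Hausdorff_space_S: "Hausdorff_space S"
    and continuous_anchor: "continuous_map S (subtopology T units) \<rho>"
    and anchor_surj: "\<rho> ` topspace S = units"
    and continuous_act:
      "continuous_map (subtopology (prod_topology T S) {(\<xi>, \<sigma>). d \<xi> = \<rho> \<sigma>}) S
        (\<lambda>(\<xi>, \<sigma>). act \<xi> \<sigma>)"
    and act_unit: "\<sigma> \<in> topspace S \<Longrightarrow> act (\<rho> \<sigma>) \<sigma> = \<sigma>"
    and anchor_act:
      "\<lbrakk>\<xi> \<in> topspace T; \<eta> \<in> topspace T; \<sigma> \<in> topspace S; d \<xi> = r \<eta>; d \<eta> = \<rho> \<sigma>\<rbrakk>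
        \<Longrightarrow> d \<xi> = \<rho> (act \<eta> \<sigma>)"
    and act_mul:
      "\<lbrakk>\<xi> \<in> topspace T; \<eta> \<in> topspace T; \<sigma> \<in> topspace S; d \<xi> = r \<eta>; d \<eta> = \<rho> \<sigma>\<rbrakk>
        \<Longrightarrow> act (mul \<xi> \<eta>) \<sigma> = act \<xi> (act \<eta> \<sigma>)"

definition translate ::
    "('g \<Rightarrow> 'g) \<Rightarrow> ('s \<Rightarrow> 'g) \<Rightarrow> ('g \<Rightarrow> 's \<Rightarrow> 's) \<Rightarrow> 'g \<Rightarrow> 's set \<Rightarrow> 's set" where
  "translate d \<rho> act \<xi> M = {act \<xi> \<sigma> |\<sigma>. \<sigma> \<in> M \<and> \<rho> \<sigma> = d \<xi>}"

definition recurrence_set ::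
    "'g set \<Rightarrow> ('g \<Rightarrow> 'g) \<Rightarrow> ('s \<Rightarrow> 'g) \<Rightarrow> ('g \<Rightarrow> 's \<Rightarrow> 's) \<Rightarrow> 's set \<Rightarrow> 's set \<Rightarrow> 'g set" where
  "recurrence_set arrows d \<rho> act M N = {\<xi> \<in> arrows. translate d \<rho> act \<xi> M \<inter> N \<noteq> {}}"

definition weakly_mixing ::
    "'g topology \<Rightarrow> ('g \<Rightarrow> 'g) \<Rightarrow> 's topology \<Rightarrow> ('s \<Rightarrow> 'g) \<Rightarrow> ('g \<Rightarrow> 's \<Rightarrow> 's) \<Rightarrow> bool" where
  "weakly_mixing T d S \<rho> act \<longleftrightarrow>
    (\<forall>U U' V V'. openin S U \<and> openin S U' \<and> openin S V \<and> openin S V' \<and>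
        U \<noteq> {} \<and> U' \<noteq> {} \<and> V \<noteq> {} \<and> V' \<noteq> {} \<longrightarrow>
      recurrence_set (topspace T) d \<rho> act U V \<inter> recurrence_set (topspace T) d \<rho> act U' V' \<noteq> {})"

end

theory Submission
  imports Defs
begin

text \<open>An arrow \<open>\<xi>\<close> moves a point \<open>\<sigma>\<close> only when \<open>\<rho> \<sigma> = d \<xi>\<close>, so a single arrow that moves points
  of two sets \<open>U\<close> and \<open>U'\<close> forces \<open>\<rho> ` U\<close> and \<open>\<rho> ` U'\<close> to meet in the source of that arrow. If the
  anchor took two different values, the Hausdorff property would separate them, and the preimages
  under \<open>\<rho>\<close> of the separating neighbourhoods would be non-empty open sets with disjoint
  images. Weak mixing provides one arrow that recurs for both preimages, a contradiction
  (\<open>weakly_mixing_imp_anchor_constant\<close>). Since the anchor is onto the units, only one unit remains;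
  all arrows are then composable and the groupoid laws become the group laws
  (\<open>groupoid.group_if_single_unit\<close>).\<close>

text \<open>The contradiction comes from the sources of arrows: with the whole space as both target sets,
  weak mixing yields one arrow whose source lies in two disjoint open sets.\<close>

lemma weakly_mixing_imp_anchor_constant:
  assumes mixing: "weakly_mixing T d S \<rho> act"
    and cont: "continuous_map S Y \<rho>"
    and Hausdorff: "Hausdorff_space Y"
    and \<sigma>: "\<sigma> \<in> topspace S" and \<tau>: "\<tau> \<in> topspace S"
  shows "\<rho> \<sigma> = \<rho> \<tau>"
proof (rule ccontr)
  assume "\<rho> \<sigma> \<noteq> \<rho> \<tau>"
  moreover have "\<rho> \<sigma> \<in> topspace Y" "\<rho> \<tau> \<in> topspace Y"
    using cont \<sigma> \<tau> by (auto dest: continuous_map_image_subset_topspace)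
  ultimately obtain A B where AB: "openin Y A" "openin Y B" "\<rho> \<sigma> \<in> A" "\<rho> \<tau> \<in> B" "disjnt A B"
    using Hausdorff unfolding Hausdorff_space_def by meson
  define U where "U = {s \<in> topspace S. \<rho> s \<in> A}"
  define U' where "U' = {s \<in> topspace S. \<rho> s \<in> B}"
  have "openin S U" "openin S U'"
    unfolding U_def U'_def using cont AB openin_continuous_map_preimage by blast+
  moreover have "U \<noteq> {}" "U' \<noteq> {}" "topspace S \<noteq> {}"
    using \<sigma> \<tau> AB unfolding U_def U'_def by auto
  ultimately have "recurrence_set (topspace T) d \<rho> act U (topspace S) \<inter>
      recurrence_set (topspace T) d \<rho> act U' (topspace S) \<noteq> {}"
    using mixing openin_topspace unfolding weakly_mixing_def by metis
  then obtain \<xi> where "translate d \<rho> act \<xi> U \<noteq> {}" "translate d \<rho> act \<xi> U' \<noteq> {}"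
    unfolding recurrence_set_def by blast
  then have "d \<xi> \<in> A" "d \<xi> \<in> B"
    unfolding translate_def U_def U'_def by auto
  with \<open>disjnt A B\<close> show False
    unfolding disjnt_def by blast
qed

lemma (in groupoid) group_if_single_unit:
  assumes "units = {x}"
  shows "group \<lparr>carrier = arrows, monoid.mult = mul, one = x\<rparr>"
proof -
  have d: "d \<xi> = x" and r: "r \<xi> = x" if "\<xi> \<in> arrows" for \<xi>
    using d_in_units[OF that] r_in_units[OF that] assms by auto
  show ?thesis
  proof (rule groupI, simp_all)
    show "mul \<xi> \<eta> \<in> arrows" if "\<xi> \<in> arrows" "\<eta> \<in> arrows" for \<xi> \<eta>
      using that mul_closed d r by simp
    show "x \<in> arrows"
      using units_subset assms by simp
    show "mul (mul \<xi> \<eta>) \<zeta> = mul \<xi> (mul \<eta> \<zeta>)"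
      if "\<xi> \<in> arrows" "\<eta> \<in> arrows" "\<zeta> \<in> arrows" for \<xi> \<eta> \<zeta>
      using that mul_assoc d r by simp
    show "mul x \<xi> = \<xi>" if "\<xi> \<in> arrows" for \<xi>
      using that r_mul_left r by force
    show "\<exists>\<eta>\<in>arrows. mul \<eta> \<xi> = x" if "\<xi> \<in> arrows" for \<xi>
      using invertible[OF that] d[OF that] unfolding is_inverse_def by auto
  qed
qed

theorem proposition8p3:
  fixes T :: "'g topology" and units :: "'g set" and d r :: "'g \<Rightarrow> 'g"
    and mul :: "'g \<Rightarrow> 'g \<Rightarrow> 'g"
    and S :: "'s topology" and \<rho> :: "'s \<Rightarrow> 'g" and act :: "'g \<Rightarrow> 's \<Rightarrow> 's"
  assumes "continuous_groupoid_action T units d r mul S \<rho> act"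
    and "topspace S \<noteq> {}"
    and "weakly_mixing T d S \<rho> act"
  shows "\<rho> ` topspace S = units \<and>
    (\<exists>x. units = {x} \<and> group \<lparr>carrier = topspace T, monoid.mult = mul, one = x\<rparr>)"
proof -
  interpret continuous_groupoid_action T units d r mul S \<rho> act
    by (fact assms(1))
  obtain \<sigma> where \<sigma>: "\<sigma> \<in> topspace S"
    using assms(2) by blast
  have "\<rho> \<tau> = \<rho> \<sigma>" if "\<tau> \<in> topspace S" for \<tau>
    using weakly_mixing_imp_anchor_constant[OF assms(3) continuous_anchor _ that \<sigma>]
      Hausdorff_arrows Hausdorff_space_subtopology by blast
  then have "\<rho> ` topspace S = {\<rho> \<sigma>}"
    using \<sigma> by blast
  then have "units = {\<rho> \<sigma>}"
    by (simp add: anchor_surj)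
  then show ?thesis
    using anchor_surj group_if_single_unit by blast
qed

end
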